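(* Let $\mathbb A=(A,+)$ be a cancellative semigroup, and let $X,Y\subseteq A$ be such that the subsemigroup $\langle Y\rangle$ generated by $Y$ is commutative. If both $X$ and $Y$ are finite and non-empty, then $|X+Y|\ge \min(\omega(Y),|X|+|Y|-1)$; otherwise $|X+Y|\ge \Omega(X,Y)$.
   Context: A semigroup $\mathbb A=(A,+)$ is a set with an associative binary operation written additively, not necessarily commutative. It is cancellative if $z+x=z+y$ or $x+z=y+z$ implies $x=y$. For $X,Y\subseteq A$, $X+Y:=\{x+y:x\in X,y\in Y\}$. $\mathbb A$ is a monoid if it has an identity $0$; a unit is an element $z$ having an inverse $\tilde z$ with $z+\tilde z=\tilde z+z=0$. $A^\times$ denotes the set of units if $\mathbb A$ is a monoid, and $A^\times:=\emptyset$ if $\mathbb A$ is not a monoid. $\langle Z\rangle$ is the smallest subsemigroup containing $Z$, and $\mathrm{ord}(z):=|\langle \{z\}\rangle|$. For $z\in A$ and a unit $z_0$ with inverse $\tilde z_0$, $z-z_0$ denotes the element $z+\tilde z_0$. For $Z\subseteq A$, $\omega(Z):=\sup_{z_0\in Z\cap A^\times}\inf_{z\in Z\setminus\{z_0\}}\mathrm{ord}(z-z_0)$, with the conventions that the supremum of the empty set is $0$ and the infimum of the empty set is $|\mathbb N|$. For $X,Y\subseteq A$: $\Omega(X,Y):=0$ if $X$ or $Y$ is empty; $\Omega(X,Y):=\max(|X|,|Y|)$ if both are non-empty and at least one is infinite; otherwise $\Omega(X,Y):=\min(\max(\omega(X),\omega(Y)),|X|+|Y|-1)$. *)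

theory Defs
  imports "HOL-Library.Extended_Nat" "HOL-Library.Set_Algebras"
begin

unbundle cardinal_syntax

definition subsemigroup :: "'a::semigroup_add set \<Rightarrow> bool" where
  "subsemigroup S \<longleftrightarrow> (\<forall>x\<in>S. \<forall>y\<in>S. x + y \<in> S)"

text \<open>The empty set counts as a subsemigroup, so the subsemigroup generated by it is empty.\<close>

definition gen :: "'a::semigroup_add set \<Rightarrow> 'a set" where
  "gen Z = subsemigroup hull Z"

text \<open>
  Orders of elements are at most countable cardinals, so they take values in \<^typ>\<open>enat\<close>,
  where \<open>\<infinity>\<close> stands for the cardinality of the natural numbers.
\<close>

definition add_ord :: "'a::semigroup_add \<Rightarrow> enat" where
  "add_ord z = (if finite (gen {z}) then enat (card (gen {z})) else \<infinity>)"

text \<open>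
  The type class \<^class>\<open>semigroup_add\<close> has no constant \<open>0\<close>; whether the semigroup is a monoid
  is expressed by the existence of an identity. If there is none, \<open>add_units\<close> is empty.
\<close>

definition is_identity :: "'a::semigroup_add \<Rightarrow> bool" where
  "is_identity e \<longleftrightarrow> (\<forall>x. e + x = x \<and> x + e = x)"

definition is_inverse :: "'a::semigroup_add \<Rightarrow> 'a \<Rightarrow> bool" where
  "is_inverse z w \<longleftrightarrow> (\<exists>e. is_identity e \<and> z + w = e \<and> w + z = e)"

definition add_units :: "'a::semigroup_add set" where
  "add_units = {z. \<exists>w. is_inverse z w}"

definition sub_unit :: "'a::semigroup_add \<Rightarrow> 'a \<Rightarrow> 'a" where
  "sub_unit z z0 = z + (THE w. is_inverse z0 w)"

lemma is_inverse_unique: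
  assumes "is_inverse z v" "is_inverse z w"
  shows "v = w"
  using assms unfolding is_inverse_def is_identity_def by (metis add.assoc)

lemma sub_unit_eq: "is_inverse z0 w \<Longrightarrow> sub_unit z z0 = z + w"
  unfolding sub_unit_def by (metis is_inverse_unique the_equality)

text \<open>In \<^typ>\<open>enat\<close>, the empty supremum is \<open>0\<close> and the empty infimum is \<open>\<infinity>\<close>.\<close>

definition omega :: "'a::semigroup_add set \<Rightarrow> enat" where
  "omega Z = (SUP z0 \<in> Z \<inter> add_units. INF z \<in> Z - {z0}. add_ord (sub_unit z z0))"

text \<open>
  \<open>Omega\<close> may be an arbitrary cardinal, so it is given as a cardinal order, living on \<^typ>\<open>'a + nat\<close>
  because its values are cardinalities of sets over \<^typ>\<open>'a\<close> in one case and elements of \<^typ>\<open>enat\<close>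
  in another. An element \<open>n\<close> of \<^typ>\<open>enat\<close> becomes the cardinality of the set of naturals less than \<open>n\<close>.
\<close>

definition Omega :: "'a::semigroup_add set \<Rightarrow> 'a set \<Rightarrow> ('a + nat) rel" where
  "Omega X Y =
    (if X = {} \<or> Y = {} then |{}|
     else if infinite X \<or> infinite Y then (if |X| \<le>o |Y| then |Inl ` Y| else |Inl ` X| )
     else |Inr ` {i. enat i < min (max (omega X) (omega Y)) (enat (card X + card Y - 1))}| )"

end

theory Submission
  imports Defs
begin

text \<open>
  Translating by a unit of \<open>Y\<close> reduces the finite case to the situation where \<open>Y\<close> contains the
  identity, which is settled by induction on \<open>|Y|\<close> with a Davenport transform. If \<open>X + Y\<close> is stable
  under adding elements of \<open>Y\<close>, it contains a translate of the subsemigroup generated by any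
  \<open>y \<in> Y\<close>. Otherwise some \<open>z \<in> X + Y + Y\<close> lies outside \<open>X + Y\<close>; removing from \<open>Y\<close> the set \<open>D\<close> of
  those \<open>y\<close> with \<open>z \<in> X + Y + y\<close> loses at least \<open>|D|\<close> elements of \<open>X + Y\<close> and keeps the identity.
\<close>

lemma add_ord_le_card_if_stable:
  fixes S :: "'a::cancel_semigroup_add set"
  assumes "finite S" "S \<noteq> {}" and stable: "\<And>s. s \<in> S \<Longrightarrow> s + y \<in> S"
  shows "add_ord y \<le> enat (card S)"
proof -
  obtain s where s: "s \<in> S" using assms by blast
  \<comment> \<open>The right stabilizer of \<open>S\<close> is closed under addition, so once it
    contains \<open>y\<close> it contains all of \<open>gen {y}\<close>. Left translation by one
    \<open>s\<close> then embeds \<open>gen {y}\<close> in \<open>S\<close>.\<close>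
  let ?T = "{w. \<forall>s\<in>S. s + w \<in> S}"
  have "subsemigroup ?T"
    unfolding subsemigroup_def by (auto simp flip: add.assoc)
  moreover have "{y} \<subseteq> ?T" using stable by simp
  ultimately have "gen {y} \<subseteq> ?T"
    unfolding gen_def by (rule hull_minimal[rotated])
  with s have sub: "(+) s ` gen {y} \<subseteq> S" by blast
  have inj: "inj_on ((+) s) (gen {y})" by (simp add: inj_on_def)
  have "finite (gen {y})"
    using finite_subset[OF sub \<open>finite S\<close>] inj by (rule finite_imageD)
  then show ?thesis
    using card_inj_on_le[OF inj sub \<open>finite S\<close>] by (simp add: add_ord_def)
qed

text \<open>Each \<open>d\<close> in \<open>D\<close> has a witness \<open>f d\<close> in
  \<open>X + Y\<close> with \<open>z = f d + d\<close>, and cancellation makes \<open>f\<close>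
  injective. No witness survives in \<open>X + (Y - D)\<close>: if \<open>f d = x + y\<close>,
  commutativity gives \<open>z = (x + d) + y\<close>, which puts \<open>y\<close> into
  \<open>D\<close>.\<close>

lemma davenport_transform:
  fixes X Y :: "'a::cancel_semigroup_add set" and z :: 'a
  assumes fin: "finite X" "finite Y" and comm: "\<And>u v. u \<in> Y \<Longrightarrow> v \<in> Y \<Longrightarrow> u + v = v + u"
  defines "D \<equiv> {y \<in> Y. \<exists>w \<in> X + Y. z = w + y}"
  shows "card (X + (Y - D)) + card D \<le> card (X + Y)"
proof -
  have "\<exists>f. \<forall>y\<in>D. f y \<in> X + Y \<and> z = f y + y"
    unfolding D_def by (intro bchoice) blast
  then obtain f where f: "\<And>y. y \<in> D \<Longrightarrow> f y \<in> X + Y" "\<And>y. y \<in> D \<Longrightarrow> z = f y + y"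
    by blast
  have "inj_on f D"
    by (rule inj_onI) (metis f(2) add_left_cancel)
  then have card_f: "card (f ` D) = card D" by (rule card_image)
  have "(X + (Y - D)) \<inter> f ` D = {}"
  proof (rule ccontr)
    assume "\<not> ?thesis"
    then obtain x y d where *: "x \<in> X" "y \<in> Y" "y \<notin> D" "d \<in> D" "f d = x + y"
      by (fastforce elim!: set_plus_elim)
    then have "d \<in> Y" by (simp add: D_def)
    have "z = x + y + d" using f(2)[OF \<open>d \<in> D\<close>] * by simp
    also have "\<dots> = (x + d) + y"
      using comm[OF \<open>y \<in> Y\<close> \<open>d \<in> Y\<close>] by (simp add: add.assoc)
    finally have "y \<in> D"
      using * \<open>d \<in> Y\<close> unfolding D_def by blast
    with * show False by blast
  qed
  moreover have "finite D" using fin by (simp add: D_def)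
  ultimately have "card (X + (Y - D) \<union> f ` D) = card (X + (Y - D)) + card D"
    using fin card_f by (subst card_Un_disjoint) (auto simp: finite_set_plus)
  moreover have "X + (Y - D) \<union> f ` D \<subseteq> X + Y"
    using f(1) by (auto elim!: set_plus_elim)
  ultimately show ?thesis
    using card_mono[of "X + Y"] fin by (metis finite_set_plus)
qed

text \<open>The bound \<open>k\<close> is fixed instead of being the infimum over \<open>Y\<close>,
  so that the hypothesis on orders passes unchanged to the smaller set \<open>Y - D\<close> in the
  induction.\<close>

lemma card_set_plus_ge_if_identity_mem:
  fixes X Y :: "'a::cancel_semigroup_add set"
  assumes "finite X" "X \<noteq> {}" "finite Y" and e: "is_identity e" "e \<in> Y"
    and comm: "\<And>u v. u \<in> Y \<Longrightarrow> v \<in> Y \<Longrightarrow> u + v = v + u"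
    and ord: "\<And>y. y \<in> Y \<Longrightarrow> y \<noteq> e \<Longrightarrow> k \<le> add_ord y"
  shows "min k (enat (card X + card Y - 1)) \<le> enat (card (X + Y))"
  using \<open>finite Y\<close> e(2) comm ord
proof (induction Y rule: finite_psubset_induct)
  case (psubset Y)
  have fin: "finite (X + Y)" using \<open>finite X\<close> \<open>finite Y\<close> by (rule finite_set_plus)
  have ne: "X + Y \<noteq> {}" using \<open>X \<noteq> {}\<close> psubset.prems(1) by (auto simp: set_plus_def)
  consider (single) "Y = {e}"
    | (stable) y where "y \<in> Y" "y \<noteq> e" "\<And>s. s \<in> X + Y \<Longrightarrow> s + y \<in> X + Y"
    | (transform) s y where "s \<in> X + Y" "y \<in> Y" "s + y \<notin> X + Y"
    using psubset.prems(1) by blast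
  then show ?case
  proof cases
    case single
    have "X + {e} = X" using e(1) by (auto simp: set_plus_def is_identity_def)
    with single show ?thesis by simp
  next
    case stable
    then have "k \<le> enat (card (X + Y))"
      using psubset.prems(3) add_ord_le_card_if_stable[OF fin ne] order_trans by blast
    then show ?thesis by (simp add: min.coboundedI1)
  next
    case transform
    define D where "D = {y' \<in> Y. \<exists>w \<in> X + Y. s + y = w + y'}"
    \<comment> \<open>The witness \<open>s\<close> puts \<open>y\<close> into \<open>D\<close>, so
      \<open>Y - D\<close> is a proper subset. If \<open>e\<close> were in \<open>D\<close>, then
      \<open>s + y = w + e = w\<close> would lie in \<open>X + Y\<close>.\<close>
    have "y \<in> D" using transform by (auto simp: D_def)
    have "e \<notin> D" using e(1) transform by (auto simp: D_def is_identity_def)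
    have "D \<subseteq> Y" by (auto simp: D_def)
    have "min k (enat (card X + card (Y - D) - 1)) \<le> enat (card (X + (Y - D)))"
      using \<open>y \<in> D\<close> \<open>D \<subseteq> Y\<close> \<open>e \<notin> D\<close> psubset.prems by (intro psubset.IH) auto
    moreover have "card (X + (Y - D)) + card D \<le> card (X + Y)"
      unfolding D_def using \<open>finite X\<close> \<open>finite Y\<close> psubset.prems(2) by (rule davenport_transform)
    moreover have "card (Y - D) + card D = card Y"
      using \<open>finite Y\<close> \<open>D \<subseteq> Y\<close>
      by (metis card_Diff_subset card_mono finite_subset le_add_diff_inverse2)
    \<comment> \<open>As \<open>Y - D\<close> is nonempty, subtracting 1 is not truncated, and
      adding \<open>card D\<close> to the bound for \<open>Y - D\<close> restores exactly the bound
      for \<open>Y\<close>.\<close>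
    moreover have "card (Y - D) \<noteq> 0"
      using \<open>finite Y\<close> \<open>e \<notin> D\<close> psubset.prems(1) by auto
    ultimately show ?thesis
      by (cases k) (auto simp: min_def split: if_splits)
  qed
qed

lemma card_set_plus_ge_if_unit_mem:
  fixes X Y :: "'a::cancel_semigroup_add set"
  assumes fin: "finite X" "X \<noteq> {}" "finite Y" and z0: "z0 \<in> Y" "z0 \<in> add_units"
    and comm: "\<And>u v. u \<in> Y \<Longrightarrow> v \<in> Y \<Longrightarrow> u + v = v + u"
  shows "min (INF z \<in> Y - {z0}. add_ord (sub_unit z z0)) (enat (card X + card Y - 1))
    \<le> enat (card (X + Y))"
proof -
  obtain w e where w: "is_inverse z0 w" and e: "is_identity e" "z0 + w = e" "w + z0 = e"
    using z0(2) by (auto simp: add_units_def is_inverse_def)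
  have e_add: "e + x = x" "x + e = x" for x
    using e(1) by (auto simp: is_identity_def)
  \<comment> \<open>The inverse \<open>w\<close> need not lie in \<open>Y\<close>, so its commuting
    with \<open>Y\<close> is derived by adding \<open>w\<close> on both sides of
    \<open>u + z0 = z0 + u\<close>.\<close>
  have comm_w: "w + u = u + w" if "u \<in> Y" for u
  proof -
    have "w + u = w + (u + z0) + w" by (simp add: add.assoc e e_add)
    also have "\<dots> = w + z0 + u + w" by (simp add: comm[OF that z0(1)] add.assoc)
    also have "\<dots> = u + w" by (simp add: e e_add)
    finally show ?thesis .
  qed
  let ?X = "(\<lambda>x. x + z0) ` X" and ?Y = "(\<lambda>y. y + w) ` Y"
  have move: "x + z0 + (y + w) = x + y" if "y \<in> Y" for x y
  proof -
    have "x + z0 + (y + w) = x + (z0 + y) + w" by (simp only: add.assoc)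
    also have "\<dots> = x + y + (z0 + w)" by (simp only: comm[OF z0(1) that] add.assoc)
    finally show ?thesis by (simp only: e e_add)
  qed
  then have sum: "?X + ?Y = X + Y"
    unfolding set_plus_def by (auto; metis imageI)
  have card: "card ?X = card X" "card ?Y = card Y"
    by (auto intro!: card_image simp: inj_on_def)
  have "u + w + (v + w) = v + w + (u + w)" if "u \<in> Y" "v \<in> Y" for u v
  proof -
    have "u + w + (v + w) = u + (w + v) + w" by (simp only: add.assoc)
    also have "\<dots> = u + v + w + w" by (simp only: comm_w[OF that(2)] add.assoc)
    also have "\<dots> = v + (u + w) + w" by (simp only: comm[OF that] add.assoc)
    also have "\<dots> = v + w + (u + w)" by (simp only: comm_w[OF that(1), symmetric] add.assoc)
    finally show ?thesis .
  qed
  \<comment> \<open>The shifted set \<open>?Y\<close> contains \<open>e = z0 + w\<close>, and any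
    other element \<open>y + w\<close> has \<open>y \<noteq> z0\<close>, so its order is one of
    those in the infimum.\<close>
  then have "min (INF z \<in> Y - {z0}. add_ord (sub_unit z z0)) (enat (card ?X + card ?Y - 1))
      \<le> enat (card (?X + ?Y))"
    using fin z0(1) e
    by (intro card_set_plus_ge_if_identity_mem[of _ _ e])
      (auto simp: sub_unit_eq[OF w, symmetric] intro!: INF_lower)
  then show ?thesis by (simp only: sum card)
qed

lemma card_of_summands_le_set_plus:
  fixes X Y :: "'a::cancel_semigroup_add set"
  assumes "X \<noteq> {}" "Y \<noteq> {}"
  shows "|X| \<le>o |X + Y|" "|Y| \<le>o |X + Y|"
proof -
  obtain x y where "x \<in> X" "y \<in> Y" using assms by blast
  then have "(\<lambda>u. u + y) ` X \<subseteq> X + Y" "(+) x ` Y \<subseteq> X + Y" by auto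
  moreover have "inj_on (\<lambda>u. u + y) X" "inj_on ((+) x) Y" by (simp_all add: inj_on_def)
  ultimately show "|X| \<le>o |X + Y|" "|Y| \<le>o |X + Y|"
    using card_of_ordLeq by blast+
qed

theorem theorem2p2:
  fixes X Y :: "'a::cancel_semigroup_add set"
  assumes "\<forall>u \<in> gen Y. \<forall>v \<in> gen Y. u + v = v + u"
  shows "if finite X \<and> X \<noteq> {} \<and> finite Y \<and> Y \<noteq> {}
         then enat (card (X + Y)) \<ge> min (omega Y) (enat (card X + card Y - 1))
         else Omega X Y \<le>o |X + Y|"
proof (cases "finite X \<and> X \<noteq> {} \<and> finite Y \<and> Y \<noteq> {}")
  case True
  have comm: "u + v = v + u" if "u \<in> Y" "v \<in> Y" for u v
    using assms that hull_subset[of Y subsemigroup] unfolding gen_def by blast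
  have "min (omega Y) (enat (card X + card Y - 1)) \<le> enat (card (X + Y))"
  \<comment> \<open>If the second term of the minimum exceeds the size of the sumset, then for every
    unit in \<open>Y\<close> the infimum is the term bounded by that size, hence so is the supremum.
    Without units in \<open>Y\<close> the supremum is 0.\<close>
  proof (cases "enat (card X + card Y - 1) \<le> enat (card (X + Y))")
    case False
    then have "omega Y \<le> enat (card (X + Y))"
      unfolding omega_def using True comm card_set_plus_ge_if_unit_mem[of X Y]
      by (intro SUP_least) (auto simp: min_le_iff_disj)
    then show ?thesis by (rule min.coboundedI1)
  qed (rule min.coboundedI2)
  with True show ?thesis by simp
next
  case False
  have "Omega X Y \<le>o |X + Y|"
  proof (cases "X = {} \<or> Y = {}")
    case True
    then show ?thesis by (auto simp: Omega_def card_of_empty)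
  next
    case nonempty: False
    \<comment> \<open>With both sets nonempty and one infinite, \<open>Omega X Y\<close> is the
      larger of the two cardinals, carried into the sum type by \<open>Inl\<close>.\<close>
    have "|Inl ` Z| \<le>o |X + Y|" if "|Z| \<le>o |X + Y|" for Z :: "'a set"
      using ordLeq_transitive[OF card_of_image that] .
    with nonempty False card_of_summands_le_set_plus[of X Y] show ?thesis
      by (auto simp: Omega_def)
  qed
  with False show ?thesis by auto
qed

end
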